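(* Let $S$ be an inverse semigroup with zero. Then the closure of the set of ultrafilters in the universal groupoid $\mathsf{G}_u(S)$ of $S$ is precisely the set of tight filters.
   Context: Inverse semigroups carry their natural partial order; $a^{\downarrow}=\{y:y\le a\}$. A filter is a non-empty, upward closed subset $F$ such that for $a,b\in F$ there is $c\in F$ with $c\le a,b$; all filters are proper ($0\notin F$). An ultrafilter is a maximal (proper) filter. The universal groupoid $\mathsf{G}_u(S)$ is, as a topological space, the set of all filters on $S$ with the topology whose basis consists of the sets $U_{x;x_1,\dots,x_n}=U_x\cap U_{x_1}^c\cap\dots\cap U_{x_n}^c$ with $x_1,\dots,x_n\le x$ in $S$, where $U_x$ is the set of all filters containing $x$ and $^c$ denotes complement. For $a\in S$ and $B\subseteq S$ write $a\to B$ if for each $0\ne x\le a$ there is $b\in B$ such that some non-zero element lies below both $x$ and $b$. Let $\mathcal{T}(a)$ be the set of all finite subsets $B\subseteq a^{\downarrow}$ with $a\to B$. A tight filter is a filter $A$ such that $x\in A$ and $X\in\mathcal{T}(x)$ imply $X\cap A\ne\emptyset$. *)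

theory Defs
  imports "HOL-Analysis.Analysis"
begin

class inverse_semigroup = semigroup_mult +
  assumes ex1_inverse: "\<exists>!y. x * y * x = x \<and> y * x * y = y"

class inverse_semigroup_with_zero = inverse_semigroup + mult_zero

definition is_idempotent :: "'a::inverse_semigroup \<Rightarrow> bool" where
  "is_idempotent e \<longleftrightarrow> e * e = e"

definition natural_le :: "'a::inverse_semigroup \<Rightarrow> 'a \<Rightarrow> bool"  (infix "\<preceq>" 50) where
  "a \<preceq> b \<longleftrightarrow> (\<exists>e. is_idempotent e \<and> a = b * e)"

definition principal_down :: "'a::inverse_semigroup \<Rightarrow> 'a set" where
  "principal_down a = {y. y \<preceq> a}"

definition is_proper_filter :: "'a::inverse_semigroup_with_zero set \<Rightarrow> bool" where
  "is_proper_filter F \<longleftrightarrow>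
     F \<noteq> {} \<and> 0 \<notin> F \<and>
     (\<forall>a b. a \<in> F \<and> a \<preceq> b \<longrightarrow> b \<in> F) \<and>
     (\<forall>a\<in>F. \<forall>b\<in>F. \<exists>c\<in>F. c \<preceq> a \<and> c \<preceq> b)"

definition is_ultrafilter :: "'a::inverse_semigroup_with_zero set \<Rightarrow> bool" where
  "is_ultrafilter F \<longleftrightarrow>
     is_proper_filter F \<and> (\<forall>G. is_proper_filter G \<and> F \<subseteq> G \<longrightarrow> G = F)"

definition filters_containing :: "'a::inverse_semigroup_with_zero \<Rightarrow> 'a set set" where
  "filters_containing x = {F. is_proper_filter F \<and> x \<in> F}"

text \<open>The set \<open>U\<^bsub>x;x\<^sub>1,\<dots>,x\<^sub>n\<^esub>\<close> with \<open>X = {x\<^sub>1,\<dots>,x\<^sub>n}\<close>; the case \<open>X = {}\<close> gives \<open>U\<^bsub>x\<^esub>\<close>.\<close>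

definition basic_open :: "'a::inverse_semigroup_with_zero \<Rightarrow> 'a set \<Rightarrow> 'a set set" where
  "basic_open x X = filters_containing x - (\<Union>y\<in>X. filters_containing y)"

definition groupoid_basis :: "'a::inverse_semigroup_with_zero set set set" where
  "groupoid_basis = {basic_open x X | x X. finite X \<and> X \<subseteq> principal_down x}"

text \<open>Only the topological space underlying the universal groupoid is defined.
  Lemmas \<open>topspace_universal_groupoid\<close> and \<open>openin_universal_groupoid\<close> below show that its
  points are exactly the filters and that the generating sets form a basis.\<close>

definition universal_groupoid :: "'a::inverse_semigroup_with_zero set topology" where
  "universal_groupoid = topology_generated_by groupoid_basis"

text \<open>\<open>arrow a B\<close> is the relation \<open>a \<rightarrow> B\<close>.\<close>

definition arrow :: "'a::inverse_semigroup_with_zero \<Rightarrow> 'a set \<Rightarrow> bool" where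
  "arrow a B \<longleftrightarrow>
     (\<forall>x. x \<noteq> 0 \<and> x \<preceq> a \<longrightarrow> (\<exists>b\<in>B. \<exists>z. z \<noteq> 0 \<and> z \<preceq> x \<and> z \<preceq> b))"

definition tight_covers :: "'a::inverse_semigroup_with_zero \<Rightarrow> 'a set set" where
  "tight_covers a = {B. finite B \<and> B \<subseteq> principal_down a \<and> arrow a B}"

definition is_tight_filter :: "'a::inverse_semigroup_with_zero set \<Rightarrow> bool" where
  "is_tight_filter A \<longleftrightarrow>
     is_proper_filter A \<and> (\<forall>x\<in>A. \<forall>X\<in>tight_covers x. X \<inter> A \<noteq> {})"

lemma idempotent_mult_commute:
  fixes e f :: "'a::inverse_semigroup"
  assumes "is_idempotent e" "is_idempotent f"
  shows "is_idempotent (e * f)" and "e * f = f * e"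
proof -
  have uniq: "y = z" if "x * y * x = x" "y * x * y = y" "x * z * x = x" "z * x * z = z"
    for x y z :: 'a
    using ex1_inverse[of x] that by blast
  have idem: "is_idempotent (e * f)" if "is_idempotent e" "is_idempotent f" for e f :: 'a
  proof -
    have e: "e * e = e" "\<And>u. e * (e * u) = e * u" and f: "f * f = f" "\<And>u. f * (f * u) = f * u"
      using that by (simp_all add: is_idempotent_def flip: mult.assoc)
    obtain x where x: "e * f * x * (e * f) = e * f" "x * (e * f) * x = x"
      using ex1_inverse[of "e * f"] by blast
    let ?g = "f * x * e"
    have g: "?g * ?g = ?g"
    proof -
      have "?g * ?g = f * (x * (e * f) * x) * e" by (simp add: mult.assoc)
      then show ?thesis by (simp add: x)
    qed
    have "?g * (e * f) * ?g = f * (x * (e * f) * x) * e"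
      by (simp add: mult.assoc e f)
    then have 1: "?g * (e * f) * ?g = ?g" by (simp add: x)
    have "(e * f) * ?g * (e * f) = e * f * x * (e * f)"
      by (simp add: mult.assoc e f)
    then have 2: "(e * f) * ?g * (e * f) = e * f" by (simp add: x)
    have "e * f = ?g"
      by (rule uniq[of ?g]) (use 1 2 g in simp_all)
    with g show ?thesis by (simp add: is_idempotent_def)
  qed
  show ef: "is_idempotent (e * f)" by (rule idem) (use assms in auto)
  have fe: "is_idempotent (f * e)" by (rule idem) (use assms in auto)
  have e: "e * e = e" "\<And>u. e * (e * u) = e * u" and f: "f * f = f" "\<And>u. f * (f * u) = f * u"
    using assms by (simp_all add: is_idempotent_def flip: mult.assoc)
  show "e * f = f * e"
    by (rule uniq[of "e * f"]) (use ef fe in \<open>simp_all add: is_idempotent_def mult.assoc e f\<close>)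
qed

lemma natural_le_trans:
  fixes a b c :: "'a::inverse_semigroup"
  assumes "a \<preceq> b" "b \<preceq> c"
  shows "a \<preceq> c"
  using assms unfolding natural_le_def by (metis idempotent_mult_commute(1) mult.assoc)

lemma natural_le_common_upper_meet:
  fixes x y z :: "'a::inverse_semigroup"
  assumes "y \<preceq> x" "z \<preceq> x"
  shows "\<exists>w. w \<preceq> y \<and> w \<preceq> z \<and> (\<forall>c. c \<preceq> y \<and> c \<preceq> z \<longrightarrow> c \<preceq> w)"
proof -
  obtain f g where f: "is_idempotent f" "y = x * f" and g: "is_idempotent g" "z = x * g"
    using assms by (auto simp: natural_le_def)
  let ?w = "x * (f * g)"
  have "?w \<preceq> y" using f g by (auto simp: natural_le_def mult.assoc)
  moreover have "?w \<preceq> z"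
    using f g idempotent_mult_commute(2)[of f g] by (auto simp: natural_le_def mult.assoc)
  moreover have "c \<preceq> ?w" if "c \<preceq> y" "c \<preceq> z" for c
  proof -
    obtain p q where p: "is_idempotent p" "c = x * f * p" and q: "is_idempotent q" "c = x * g * q"
      using \<open>c \<preceq> y\<close> \<open>c \<preceq> z\<close> f g by (auto simp: natural_le_def)
    have "c * g = x * (g * (q * g))" by (simp add: q mult.assoc)
    also have "q * g = g * q" using idempotent_mult_commute(2) q g by blast
    also have "x * (g * (g * q)) = c"
      using g q by (simp add: is_idempotent_def flip: mult.assoc)
    finally have "c = c * g" by simp
    also have "\<dots> = x * f * (p * g)" by (simp add: p mult.assoc)
    also have "p * g = g * p" using idempotent_mult_commute(2) p g by blast
    finally show ?thesis using p by (auto simp: natural_le_def mult.assoc)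
  qed
  ultimately show ?thesis by blast
qed

lemma proper_filter_upward: "is_proper_filter F \<Longrightarrow> a \<in> F \<Longrightarrow> a \<preceq> b \<Longrightarrow> b \<in> F"
  unfolding is_proper_filter_def by blast

lemma proper_filter_directed:
  assumes "is_proper_filter F" "a \<in> F" "b \<in> F"
  obtains c where "c \<in> F" "c \<preceq> a" "c \<preceq> b"
  using assms unfolding is_proper_filter_def by metis

lemma basic_open_shrink:
  assumes "finite X" "X \<subseteq> principal_down x" "z \<preceq> x"
  obtains X' where "finite X'" "X' \<subseteq> principal_down z"
    "basic_open z X' = filters_containing z - (\<Union>y\<in>X. filters_containing y)"
proof -
  have "\<forall>y\<in>X. \<exists>w. w \<preceq> y \<and> w \<preceq> z \<and> (\<forall>c. c \<preceq> y \<and> c \<preceq> z \<longrightarrow> c \<preceq> w)"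
    using assms natural_le_common_upper_meet[of _ x z] unfolding principal_down_def by blast
  then obtain w where w: "\<And>y. y \<in> X \<Longrightarrow> w y \<preceq> y" "\<And>y. y \<in> X \<Longrightarrow> w y \<preceq> z"
    "\<And>y c. y \<in> X \<Longrightarrow> c \<preceq> y \<Longrightarrow> c \<preceq> z \<Longrightarrow> c \<preceq> w y"
    by metis
  have mem: "w y \<in> F \<longleftrightarrow> y \<in> F" if F: "is_proper_filter F" "z \<in> F" "y \<in> X" for F y
  proof
    show "w y \<in> F \<Longrightarrow> y \<in> F"
      using that w(1) by (blast intro: proper_filter_upward)
    assume "y \<in> F"
    then obtain c where "c \<in> F" "c \<preceq> y" "c \<preceq> z"
      using proper_filter_directed F by metis
    then show "w y \<in> F"
      using that w(3) by (blast intro: proper_filter_upward)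
  qed
  show ?thesis
  proof
    show "finite (w ` X)" using assms by simp
    show "w ` X \<subseteq> principal_down z" using w by (auto simp: principal_down_def)
    show "basic_open z (w ` X) = filters_containing z - (\<Union>y\<in>X. filters_containing y)"
      using mem by (auto simp: basic_open_def filters_containing_def)
  qed
qed

lemma groupoid_basis_Int:
  assumes "U \<in> groupoid_basis" "V \<in> groupoid_basis" "F \<in> U \<inter> V"
  shows "\<exists>W\<in>groupoid_basis. F \<in> W \<and> W \<subseteq> U \<inter> V"
proof -
  obtain x X where U: "U = basic_open x X" "finite X" "X \<subseteq> principal_down x"
    using assms(1) by (auto simp: groupoid_basis_def)
  obtain y Y where V: "V = basic_open y Y" "finite Y" "Y \<subseteq> principal_down y"
    using assms(2) by (auto simp: groupoid_basis_def)
  have F: "is_proper_filter F" "x \<in> F" "y \<in> F"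
    using assms(3) U V by (auto simp: basic_open_def filters_containing_def)
  then obtain z where z: "z \<in> F" "z \<preceq> x" "z \<preceq> y"
    using proper_filter_directed by metis
  obtain X' where X': "finite X'" "X' \<subseteq> principal_down z"
    "basic_open z X' = filters_containing z - (\<Union>y\<in>X. filters_containing y)"
    using basic_open_shrink[OF U(2,3) z(2)] .
  obtain Y' where Y': "finite Y'" "Y' \<subseteq> principal_down z"
    "basic_open z Y' = filters_containing z - (\<Union>y\<in>Y. filters_containing y)"
    using basic_open_shrink[OF V(2,3) z(3)] .
  have sub: "filters_containing z \<subseteq> filters_containing x \<inter> filters_containing y"
    using z unfolding filters_containing_def by (blast intro: proper_filter_upward)
  have eq: "basic_open z (X' \<union> Y') = basic_open z X' \<inter> basic_open z Y'"
    by (auto simp: basic_open_def)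
  have "basic_open z (X' \<union> Y') \<in> groupoid_basis"
    unfolding groupoid_basis_def mem_Collect_eq
    using X'(1,2) Y'(1,2) by (intro exI[of _ z] exI[of _ "X' \<union> Y'"]) simp
  moreover have "F \<in> basic_open z (X' \<union> Y')"
    using assms(3) F z unfolding eq X' Y' U V by (auto simp: basic_open_def filters_containing_def)
  moreover have "basic_open z (X' \<union> Y') \<subseteq> U \<inter> V"
    using sub unfolding eq X' Y' U V by (auto simp: basic_open_def)
  ultimately show ?thesis by blast
qed

lemma topspace_universal_groupoid: "topspace universal_groupoid = {F. is_proper_filter F}"
proof -
  have "\<exists>U\<in>groupoid_basis. F \<in> U" if F: "is_proper_filter F" for F :: "'a set"
  proof -
    obtain x where "x \<in> F" using F by (auto simp: is_proper_filter_def)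
    then have "F \<in> basic_open x {}" using F by (simp add: basic_open_def filters_containing_def)
    moreover have "basic_open x {} \<in> groupoid_basis" by (auto simp: groupoid_basis_def)
    ultimately show ?thesis by blast
  qed
  moreover have "is_proper_filter F" if "F \<in> U" "U \<in> groupoid_basis" for F :: "'a set" and U
    using that by (auto simp: groupoid_basis_def basic_open_def filters_containing_def)
  ultimately show ?thesis
    unfolding universal_groupoid_def topology_generated_by_topspace by blast
qed

lemma openin_universal_groupoid:
  "openin universal_groupoid = arbitrary union_of (\<lambda>U. U \<in> groupoid_basis)"
proof -
  have "\<exists>V. V \<in> groupoid_basis \<and> F \<in> V \<and> V \<subseteq> U"
    if "generate_topology_on groupoid_basis U" "F \<in> U" for U and F :: "'a set"
    using that
  proof (induction U arbitrary: F rule: generate_topology_on.induct)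
    case Empty
    then show ?case by simp
  next
    case (Int a b)
    then obtain V V' where "V \<in> groupoid_basis" "F \<in> V" "V \<subseteq> a"
        "V' \<in> groupoid_basis" "F \<in> V'" "V' \<subseteq> b"
      by (meson IntD1 IntD2)
    then show ?case using groupoid_basis_Int[of V V' F] by blast
  next
    case (UN K)
    then show ?case by (meson Sup_upper UnionE order_trans)
  next
    case (Basis s)
    then show ?case by blast
  qed
  then show ?thesis
    unfolding openin_topology_base_unique universal_groupoid_def
    by (auto simp: openin_topology_generated_by_iff intro: generate_topology_on.Basis)
qed

end

theory Submission
  imports Defs
begin

text \<open>An ultrafilter \<open>A\<close> that omits some \<open>y \<preceq> x \<in> A\<close> contains an element disjoint from \<open>y\<close>:
  otherwise the meets of \<open>y\<close> with elements of \<open>A\<close> below \<open>x\<close> would generate a larger proper filter.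
  Hence ultrafilters are tight, and tightness passes to the closure because its failure is
  witnessed by a basic open neighbourhood \<open>basic_open x X\<close>.
  Conversely, if \<open>A\<close> is tight and lies in \<open>basic_open x X\<close>, then \<open>x \<rightarrow> X\<close> fails at some non-zero
  \<open>z \<preceq> x\<close>, and any ultrafilter containing \<open>z\<close> lies in \<open>basic_open x X\<close>.\<close>

lemma natural_le_refl: "(a::'a::inverse_semigroup) \<preceq> a"
proof -
  obtain b where "a * b * a = a" "b * a * b = b"
    using ex1_inverse[of a] by blast
  then have "is_idempotent (b * a)" "a = a * (b * a)"
    by (simp_all add: is_idempotent_def flip: mult.assoc)
  then show ?thesis unfolding natural_le_def by blast
qed

lemma natural_le_zero: "(a::'a::inverse_semigroup_with_zero) \<preceq> 0 \<Longrightarrow> a = 0"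
  by (auto simp: natural_le_def)

lemma proper_filter_nonzero: "is_proper_filter F \<Longrightarrow> a \<in> F \<Longrightarrow> a \<noteq> 0"
  unfolding is_proper_filter_def by blast

lemma proper_filter_principal:
  fixes z :: "'a::inverse_semigroup_with_zero"
  assumes "z \<noteq> 0"
  shows "is_proper_filter {y. z \<preceq> y}"
  unfolding is_proper_filter_def
proof (intro conjI allI impI ballI)
  show "{y. z \<preceq> y} \<noteq> {}" using natural_le_refl[of z] by blast
  show "0 \<notin> {y. z \<preceq> y}" using assms natural_le_zero by blast
  show "b \<in> {y. z \<preceq> y}" if "a \<in> {y. z \<preceq> y} \<and> a \<preceq> b" for a b
    using that natural_le_trans[of z a b] by simp
  show "\<exists>c\<in>{y. z \<preceq> y}. c \<preceq> a \<and> c \<preceq> b" if "a \<in> {y. z \<preceq> y}" "b \<in> {y. z \<preceq> y}" for a b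
    using that natural_le_refl[of z] by blast
qed

text \<open>This bounds chains for Zorn's lemma. By linearity any two elements of the union lie in
  one member of \<open>C\<close>, which supplies their common lower bound; an empty \<open>C\<close>
  would give the empty set, not a filter.\<close>

lemma proper_filter_Union_chain:
  assumes "subset.chain {F. is_proper_filter F} C" "C \<noteq> {}"
  shows "is_proper_filter (\<Union>C)"
proof -
  have filt: "\<And>F. F \<in> C \<Longrightarrow> is_proper_filter F"
    and lin: "\<And>F G. F \<in> C \<Longrightarrow> G \<in> C \<Longrightarrow> F \<subseteq> G \<or> G \<subseteq> F"
    using assms(1) by (auto simp: subset_chain_def)
  have "\<exists>c\<in>\<Union>C. c \<preceq> a \<and> c \<preceq> b" if "a \<in> \<Union>C" "b \<in> \<Union>C" for a b
  proof -
    obtain G H where "G \<in> C" "a \<in> G" "H \<in> C" "b \<in> H"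
      using \<open>a \<in> \<Union>C\<close> \<open>b \<in> \<Union>C\<close> by blast
    then obtain F where F: "F \<in> C" "a \<in> F" "b \<in> F"
      using lin[of G H] by blast
    obtain c where "c \<in> F" "c \<preceq> a" "c \<preceq> b"
      using proper_filter_directed[OF filt[OF F(1)] F(2,3)] .
    then show ?thesis using F(1) by blast
  qed
  moreover have "\<Union>C \<noteq> {}"
    using assms(2) filt unfolding is_proper_filter_def by blast
  moreover have "0 \<notin> \<Union>C"
    using filt proper_filter_nonzero by blast
  moreover have "b \<in> \<Union>C" if "a \<in> \<Union>C" "a \<preceq> b" for a b
    using that filt by (blast intro: proper_filter_upward)
  ultimately show ?thesis
    unfolding is_proper_filter_def by blast
qed

lemma ex_ultrafilter_superset:
  assumes "is_proper_filter F"
  obtains A where "is_ultrafilter A" "F \<subseteq> A"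
proof -
  let ?S = "{G. is_proper_filter G \<and> F \<subseteq> G}"
  have "\<exists>M\<in>?S. \<forall>G\<in>?S. M \<subseteq> G \<longrightarrow> G = M"
  proof (rule subset_Zorn_nonempty)
    show "?S \<noteq> {}" using assms by blast
    fix C assume C: "C \<noteq> {}" "subset.chain ?S C"
    have "subset.chain {F. is_proper_filter F} C"
      using C(2) by (auto simp: subset_chain_def)
    moreover have "F \<subseteq> \<Union>C"
      using C unfolding subset_chain_def by blast
    ultimately show "\<Union>C \<in> ?S"
      using C(1) proper_filter_Union_chain by blast
  qed
  then obtain M where M: "M \<in> ?S" "\<forall>G\<in>?S. M \<subseteq> G \<longrightarrow> G = M" ..
  \<comment> \<open>Maximality above \<open>F\<close> is full maximality, because every proper
    filter containing \<open>M\<close> also contains \<open>F\<close>.\<close>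
  then have "is_ultrafilter M"
    unfolding is_ultrafilter_def by auto
  then show ?thesis using M(1) that by simp
qed

lemma ultrafilter_disjoint_element:
  assumes A: "is_ultrafilter A" and x: "x \<in> A" and y: "y \<preceq> x" "y \<notin> A"
  shows "\<exists>a\<in>A. \<forall>z. z \<preceq> a \<and> z \<preceq> y \<longrightarrow> z = 0"
proof (rule ccontr)
  assume meets: "\<not> ?thesis"
  have F: "is_proper_filter A"
    using A by (simp add: is_ultrafilter_def)
  \<comment> \<open>A common lower bound of elements below \<open>x\<close> factors through their meet, so this is the
    filter generated by the meets of \<open>y\<close> with elements of \<open>A\<close>, described without choosing meets.\<close>
  define G where "G = {g. \<exists>a\<in>A. \<forall>w. w \<preceq> a \<and> w \<preceq> y \<longrightarrow> w \<preceq> g}"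
  have sub: "A \<subseteq> G" and yG: "y \<in> G"
    using x by (auto simp: G_def)
  \<comment> \<open>If \<open>0\<close> were in \<open>G\<close>, some element of \<open>A\<close>
    would have only \<open>0\<close> as a common lower bound with \<open>y\<close>, against
    \<open>meets\<close>.\<close>
  have "0 \<notin> G"
    using meets natural_le_zero unfolding G_def by blast
  moreover have "h \<in> G" if "g \<in> G" "g \<preceq> h" for g h
    using that unfolding G_def by (blast intro: natural_le_trans)
  moreover have "\<exists>c\<in>G. c \<preceq> g \<and> c \<preceq> h" if "g \<in> G" "h \<in> G" for g h
  proof -
    obtain a b where ab: "a \<in> A" "b \<in> A"
        "\<And>w. w \<preceq> a \<Longrightarrow> w \<preceq> y \<Longrightarrow> w \<preceq> g" "\<And>w. w \<preceq> b \<Longrightarrow> w \<preceq> y \<Longrightarrow> w \<preceq> h"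
      using \<open>g \<in> G\<close> \<open>h \<in> G\<close> unfolding G_def by blast
    obtain d where d: "d \<in> A" "d \<preceq> a" "d \<preceq> b"
      using proper_filter_directed[OF F ab(1,2)] .
    \<comment> \<open>Two arbitrary elements need not have a meet. Descending below \<open>x\<close>
      gives \<open>c\<close> and \<open>y\<close> a common upper bound, so their meet
      \<open>w\<close> exists, and \<open>c\<close> witnesses that it lies in
      \<open>G\<close>.\<close>
    obtain c where c: "c \<in> A" "c \<preceq> d" "c \<preceq> x"
      using proper_filter_directed[OF F d(1) x] .
    obtain w where w: "w \<preceq> c" "w \<preceq> y" "\<And>u. u \<preceq> c \<Longrightarrow> u \<preceq> y \<Longrightarrow> u \<preceq> w"
      using natural_le_common_upper_meet[OF c(3) y(1)] by blast
    have "w \<in> G"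
      using c(1) w(3) unfolding G_def by blast
    moreover have "w \<preceq> d"
      using w(1) c(2) by (rule natural_le_trans)
    then have "w \<preceq> g" "w \<preceq> h"
      using ab(3,4) d(2,3) w(2) natural_le_trans[of w d] by blast+
    ultimately show ?thesis by blast
  qed
  ultimately have "is_proper_filter G"
    using yG unfolding is_proper_filter_def by blast
  then have "G = A"
    using A sub unfolding is_ultrafilter_def by blast
  then show False using yG y(2) by blast
qed

lemma proper_filter_finite_lower_bound:
  assumes F: "is_proper_filter F" and "finite X" "X \<subseteq> F"
  shows "\<exists>c\<in>F. \<forall>a\<in>X. c \<preceq> a"
  using assms(2,3)
proof (induction X rule: finite_induct)
  case empty
  then show ?case using F by (auto simp: is_proper_filter_def)
next
  case (insert a X)
  then obtain c where c: "c \<in> F" "\<And>b. b \<in> X \<Longrightarrow> c \<preceq> b" by auto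
  obtain d where "d \<in> F" "d \<preceq> c" "d \<preceq> a"
    using proper_filter_directed[OF F c(1), of a] insert.prems by blast
  then show ?case using c(2) by (auto intro: natural_le_trans)
qed

text \<open>If a finite cover \<open>X\<close> of \<open>x\<close> missed \<open>A\<close>, each of
  its elements would be disjoint from some element of \<open>A\<close>. As \<open>X\<close> is
  finite, one non-zero \<open>c\<close> in \<open>A\<close> lies below \<open>x\<close> and all
  these elements, so \<open>c\<close> refutes \<open>arrow x X\<close>.\<close>

lemma ultrafilter_imp_tight_filter:
  assumes A: "is_ultrafilter A"
  shows "is_tight_filter A"
  unfolding is_tight_filter_def
proof (intro conjI ballI notI)
  show F: "is_proper_filter A"
    using A by (simp add: is_ultrafilter_def)
  fix x X assume x: "x \<in> A" and "X \<in> tight_covers x" and disj: "X \<inter> A = {}"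
  then have X: "finite X" "\<And>y. y \<in> X \<Longrightarrow> y \<preceq> x" "arrow x X"
    by (auto simp: tight_covers_def principal_down_def)
  have "\<exists>a\<in>A. \<forall>z. z \<preceq> a \<and> z \<preceq> y \<longrightarrow> z = 0" if "y \<in> X" for y
    using ultrafilter_disjoint_element[OF A x X(2)[OF that]] that disj by blast
  then obtain a where a: "\<And>y. y \<in> X \<Longrightarrow> a y \<in> A"
      "\<And>y z. y \<in> X \<Longrightarrow> z \<preceq> a y \<Longrightarrow> z \<preceq> y \<Longrightarrow> z = 0"
    by metis
  obtain c where c: "c \<in> A" "c \<preceq> x" "\<And>y. y \<in> X \<Longrightarrow> c \<preceq> a y"
    using proper_filter_finite_lower_bound[OF F, of "insert x (a ` X)"] X(1) x a(1) by auto
  have "c \<noteq> 0"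
    using F c(1) by (rule proper_filter_nonzero)
  then obtain b z where z: "b \<in> X" "z \<noteq> 0" "z \<preceq> c" "z \<preceq> b"
    using X(3) c(2) unfolding arrow_def by blast
  have "z \<preceq> a b"
    using z(3) c(3)[OF z(1)] by (rule natural_le_trans)
  then show False
    using a(2) z by blast
qed

lemma mem_basic_open_iff:
  "A \<in> basic_open x X \<longleftrightarrow> is_proper_filter A \<and> x \<in> A \<and> X \<inter> A = {}"
  by (auto simp: basic_open_def filters_containing_def)

text \<open>Failure of the arrow gives a non-zero \<open>z\<close> below \<open>x\<close> that is
  disjoint from every element of \<open>X\<close>. An ultrafilter through \<open>z\<close> contains
  \<open>x\<close>; if it contained some \<open>b\<close> in \<open>X\<close>, directedness would
  put a non-zero element below both \<open>z\<close> and \<open>b\<close>.\<close>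

lemma basic_open_contains_ultrafilter:
  assumes "\<not> arrow x X"
  shows "\<exists>A. is_ultrafilter A \<and> A \<in> basic_open x X"
proof -
  obtain z where z: "z \<noteq> 0" "z \<preceq> x" "\<And>b w. b \<in> X \<Longrightarrow> w \<preceq> z \<Longrightarrow> w \<preceq> b \<Longrightarrow> w = 0"
    using assms unfolding arrow_def by blast
  obtain A where A: "is_ultrafilter A" "{y. z \<preceq> y} \<subseteq> A"
    using ex_ultrafilter_superset[OF proper_filter_principal[OF z(1)]] .
  have F: "is_proper_filter A"
    using A(1) by (simp add: is_ultrafilter_def)
  have "z \<in> A" "x \<in> A"
    using A(2) z(2) natural_le_refl[of z] by blast+
  moreover have "b \<notin> A" if "b \<in> X" for b
    using proper_filter_directed[OF F \<open>z \<in> A\<close>] proper_filter_nonzero[OF F] z(3)[OF that] by metis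
  ultimately show ?thesis
    using A(1) F by (auto simp: mem_basic_open_iff)
qed

lemma openin_basic_open:
  assumes "finite X" "X \<subseteq> principal_down x"
  shows "openin universal_groupoid (basic_open x X)"
  unfolding universal_groupoid_def
  by (rule topology_generated_by_Basis) (use assms in \<open>auto simp: groupoid_basis_def\<close>)

text \<open>Every open set is a union of basic ones, so testing basic neighbourhoods suffices. This
  turns closure into a condition on elements of the semigroup.\<close>

lemma in_closure_of_universal_groupoid:
  "A \<in> universal_groupoid closure_of S \<longleftrightarrow>
     is_proper_filter A \<and>
     (\<forall>x X. finite X \<and> X \<subseteq> principal_down x \<and> A \<in> basic_open x X \<longrightarrow> S \<inter> basic_open x X \<noteq> {})"
    (is "_ \<longleftrightarrow> _ \<and> ?meets")
proof -
  have "(\<forall>U. A \<in> U \<and> openin universal_groupoid U \<longrightarrow> (\<exists>B. B \<in> S \<and> B \<in> U)) \<longleftrightarrow> ?meets"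
  proof
    assume "\<forall>U. A \<in> U \<and> openin universal_groupoid U \<longrightarrow> (\<exists>B. B \<in> S \<and> B \<in> U)"
    then show ?meets using openin_basic_open by blast
  next
    assume meets: ?meets
    show "\<forall>U. A \<in> U \<and> openin universal_groupoid U \<longrightarrow> (\<exists>B. B \<in> S \<and> B \<in> U)"
    proof (intro allI impI)
      fix U assume "A \<in> U \<and> openin universal_groupoid U"
      then obtain V where "V \<in> groupoid_basis" "A \<in> V" "V \<subseteq> U"
        unfolding openin_universal_groupoid arbitrary_union_of_alt by blast
      then show "\<exists>B. B \<in> S \<and> B \<in> U"
        using meets unfolding groupoid_basis_def by blast
    qed
  qed
  then show ?thesis
    unfolding in_closure_of topspace_universal_groupoid mem_Collect_eq by (rule arg_cong)
qed

theorem theorem5p13: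
  "(universal_groupoid :: 'a::inverse_semigroup_with_zero set topology)
     closure_of {A. is_ultrafilter A} = {A. is_tight_filter A}"
proof (intro set_eqI iffI; simp only: mem_Collect_eq)
  fix A :: "'a set"
  assume A: "A \<in> universal_groupoid closure_of {A. is_ultrafilter A}"
  show "is_tight_filter A"
    unfolding is_tight_filter_def
  proof (intro conjI ballI notI)
    show F: "is_proper_filter A"
      using A by (simp add: in_closure_of_universal_groupoid)
    fix x X assume x: "x \<in> A" "X \<inter> A = {}" and X: "X \<in> tight_covers x"
    have "finite X" "X \<subseteq> principal_down x"
      using X by (simp_all add: tight_covers_def)
    moreover have "A \<in> basic_open x X"
      using F x by (simp add: mem_basic_open_iff)
    ultimately have "{A. is_ultrafilter A} \<inter> basic_open x X \<noteq> {}"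
      using A unfolding in_closure_of_universal_groupoid by blast
    then obtain B where "is_ultrafilter B" "B \<in> basic_open x X" by blast
    \<comment> \<open>The ultrafilter \<open>B\<close> is tight and contains \<open>x\<close>, so it
      must meet the cover \<open>X\<close>, but \<open>basic_open x X\<close> forbids this.\<close>
    then show False
      using X ultrafilter_imp_tight_filter unfolding is_tight_filter_def mem_basic_open_iff by blast
  qed
next
  fix A :: "'a set"
  assume A: "is_tight_filter A"
  have "{A. is_ultrafilter A} \<inter> basic_open x X \<noteq> {}"
    if "finite X" "X \<subseteq> principal_down x" "A \<in> basic_open x X" for x X
  proof -
    \<comment> \<open>Otherwise \<open>X\<close> would be a finite cover of \<open>x\<close>, and
      tightness would make \<open>A\<close> meet \<open>X\<close>.\<close>
    have "\<not> arrow x X"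
      using A that unfolding is_tight_filter_def tight_covers_def mem_basic_open_iff by blast
    then show ?thesis
      using basic_open_contains_ultrafilter by blast
  qed
  then show "A \<in> universal_groupoid closure_of {A. is_ultrafilter A}"
    using A unfolding in_closure_of_universal_groupoid is_tight_filter_def by blast
qed

end
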